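(* Fix a constant $\alpha\in(0,1)$ and let $\varphi:[-1,1]\to[0,\infty)$ be a given continuous convex surrogate. Assume further that there exists $\nu_0>0$ such that the set of classifiers $\mathcal{H}^{\varphi,\alpha-\nu_0}$ is nonempty. Then, for any $\nu\in(0,\nu_0)$, $$\min_{h\in\mathcal{H}^{\varphi,\alpha-\nu}}R_\varphi^+(h)-\min_{h\in\mathcal{H}^{\varphi,\alpha}}R_\varphi^+(h)\le\varphi(1)\frac{\nu}{\nu_0-\nu}.$$
   Context: A convex surrogate is a function $\varphi:[-1,1]\to[0,\infty)$ that is non-decreasing, continuous and convex with $\varphi(0)=1$. Let $\mathcal{X}\subset\mathbb{R}^d$ and let $P^-$, $P^+$ be probability distributions on $\mathcal{X}$ (the conditional distributions of $X$ given the label $Y=-1$, respectively $Y=1$). A classifier is a (measurable) map $h:\mathcal{X}\to[-1,1]$. Let $h_1,\dots,h_M$, $M\ge2$, be fixed classifiers, let $\Lambda=\{\lambda\in\mathbb{R}^M:\lambda_j\ge0,\ \sum_{j=1}^M\lambda_j=1\}$ and $\mathcal{H}^{\mathrm{conv}}=\{\sum_{j=1}^M\lambda_jh_j:\lambda\in\Lambda\}$. Define $R_\varphi^-(h)=\mathbb{E}_{X\sim P^-}[\varphi(h(X))]$, $R_\varphi^+(h)=\mathbb{E}_{X\sim P^+}[\varphi(-h(X))]$, and for real $a$, $\mathcal{H}^{\varphi,a}=\{h\in\mathcal{H}^{\mathrm{conv}}:R_\varphi^-(h)\le a\}$. *)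

theory Defs
  imports "HOL-Probability.Probability"
begin

definition convex_surrogate :: "(real \<Rightarrow> real) \<Rightarrow> bool" where
  "convex_surrogate \<phi> \<longleftrightarrow>
     \<phi> \<in> {-1..1} \<rightarrow> {0..} \<and> mono_on {-1..1} \<phi> \<and> continuous_on {-1..1} \<phi> \<and>
     convex_on {-1..1} \<phi> \<and> \<phi> 0 = 1"

(* The domain X is an arbitrary subset of R^d, equipped with the trace of the Borel sigma-algebra.
   Functions on X are total functions on R^d; their values outside X play no role. *)

definition distribution_on :: "(real ^ 'd) set \<Rightarrow> (real ^ 'd) measure \<Rightarrow> bool" where
  "distribution_on X P \<longleftrightarrow> prob_space P \<and> sets P = sets (restrict_space borel X)"

definition classifier :: "(real ^ 'd) set \<Rightarrow> (real ^ 'd \<Rightarrow> real) \<Rightarrow> bool" where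
  "classifier X h \<longleftrightarrow> h \<in> restrict_space borel X \<rightarrow>\<^sub>M restrict_space borel {-1..1}"

definition simplex_weights :: "(real ^ 'm) set" where
  "simplex_weights = {w. (\<forall>j. 0 \<le> w $ j) \<and> (\<Sum>j\<in>UNIV. w $ j) = 1}"

definition H_conv :: "('m::finite \<Rightarrow> real ^ 'd \<Rightarrow> real) \<Rightarrow> (real ^ 'd \<Rightarrow> real) set" where
  "H_conv hs = {(\<lambda>x. \<Sum>j\<in>UNIV. w $ j * hs j x) | w. w \<in> simplex_weights}"

definition R_neg :: "(real ^ 'd) measure \<Rightarrow> (real \<Rightarrow> real) \<Rightarrow> (real ^ 'd \<Rightarrow> real) \<Rightarrow> real" where
  "R_neg Pneg \<phi> h = (LINT x|Pneg. \<phi> (h x))"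

definition R_pos :: "(real ^ 'd) measure \<Rightarrow> (real \<Rightarrow> real) \<Rightarrow> (real ^ 'd \<Rightarrow> real) \<Rightarrow> real" where
  "R_pos Ppos \<phi> h = (LINT x|Ppos. \<phi> (- h x))"

definition H_level :: "(real ^ 'd) measure \<Rightarrow> (real \<Rightarrow> real) \<Rightarrow> ('m::finite \<Rightarrow> real ^ 'd \<Rightarrow> real) \<Rightarrow>
    real \<Rightarrow> (real ^ 'd \<Rightarrow> real) set" where
  "H_level Pneg \<phi> hs a = {h \<in> H_conv hs. R_neg Pneg \<phi> h \<le> a}"

end

theory Submission
  imports Defs
begin

text \<open>
  Existence of the minima is compactness of the weight simplex together with continuity of both
  risks in the weights (dominated convergence). For the bound, let \<open>g\<close> be optimal at level
  \<open>\<alpha>\<close> and \<open>h\<close> feasible at level \<open>\<alpha> - \<nu>0\<close>: by convexity the mixture \<open>(1 - t) g + t h\<close> with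
  \<open>t = \<nu> / \<nu>0\<close> is feasible at level \<open>\<alpha> - \<nu>\<close>, and its positive risk exceeds the optimum by at most
  \<open>t \<phi>(1)\<close>, which is even smaller than the claimed bound.
\<close>

text \<open>Exhibits the combined classifier as a function of its weight vector, so that minimising
  over \<open>H_conv hs\<close> becomes minimising over a subset of a finite-dimensional
  space.\<close>

definition mix :: "('m::finite \<Rightarrow> 'a \<Rightarrow> real) \<Rightarrow> real ^ 'm \<Rightarrow> 'a \<Rightarrow> real" where
  "mix f w x = (\<Sum>j\<in>UNIV. w $ j * f j x)"

lemma H_conv_eq_image: "H_conv hs = mix hs ` simplex_weights"
  by (auto simp: H_conv_def mix_def fun_eq_iff image_def)

lemma mix_uminus: "mix (\<lambda>j x. - f j x) w x = - mix f w x"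
  by (simp add: mix_def sum_negf)

lemma mix_convex_combination:
  "mix f (a *\<^sub>R v + b *\<^sub>R w) x = a * mix f v x + b * mix f w x"
  by (simp add: mix_def algebra_simps sum.distrib sum_distrib_left)

lemma simplex_weights_convex: "convex (simplex_weights :: (real ^ 'm::finite) set)"
  by (auto simp: convex_def simplex_weights_def sum.distrib sum_distrib_left[symmetric])

text \<open>Boundedness comes from the l1 norm, which dominates the Euclidean norm and equals 1 for
  nonnegative weights summing to 1.\<close>

lemma simplex_weights_compact: "compact (simplex_weights :: (real ^ 'm::finite) set)"
proof -
  have "closed {w :: real ^ 'm. (\<forall>j. 0 \<le> w $ j) \<and> (\<Sum>j\<in>UNIV. w $ j) = 1}"
    by (intro closed_Collect_conj closed_Collect_all closed_Collect_le closed_Collect_eq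
        continuous_intros)
  moreover have "norm w \<le> 1" if "w \<in> simplex_weights" for w :: "real ^ 'm"
    using that norm_le_l1_cart[of w] by (simp add: simplex_weights_def)
  ultimately show ?thesis
    unfolding compact_eq_bounded_closed bounded_iff by (auto simp: simplex_weights_def)
qed

lemma mix_in_interval:
  assumes "w \<in> simplex_weights" and "\<And>j. f j x \<in> {-1..1}"
  shows "mix f w x \<in> {-1..1}"
proof -
  have "(\<Sum>j\<in>UNIV. w $ j *\<^sub>R f j x) \<in> {-1..1}"
    by (rule convex_sum) (use assms in \<open>auto simp: simplex_weights_def\<close>)
  then show ?thesis by (simp add: mix_def)
qed

lemma convex_surrogate_bounds:
  assumes "convex_surrogate \<phi>" and "y \<in> {-1..1}"
  shows "0 \<le> \<phi> y" and "\<phi> y \<le> \<phi> 1"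
proof -
  show "0 \<le> \<phi> y"
    using assms by (auto simp: convex_surrogate_def)
  show "\<phi> y \<le> \<phi> 1"
    using assms by (auto simp: convex_surrogate_def intro: mono_onD)
qed

text \<open>The positive risk is the negative risk of the negated functions, so the analytic facts below
  are only needed for one of them.\<close>

locale surrogate_risk = prob_space P
  for P :: "(real ^ 'd) measure" +
  fixes f :: "'m::finite \<Rightarrow> real ^ 'd \<Rightarrow> real" and \<phi> :: "real \<Rightarrow> real"
  assumes surrogate: "convex_surrogate \<phi>"
    and meas: "\<And>j. f j \<in> borel_measurable P"
    and range: "\<And>j x. x \<in> space P \<Longrightarrow> f j x \<in> {-1..1}"
begin

lemma mix_range: "w \<in> simplex_weights \<Longrightarrow> x \<in> space P \<Longrightarrow> mix f w x \<in> {-1..1}"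
  by (intro mix_in_interval range)

lemma surrogate_mix_measurable:
  assumes "w \<in> simplex_weights"
  shows "(\<lambda>x. \<phi> (mix f w x)) \<in> borel_measurable P"
\<comment> \<open>Continuity of \<open>\<phi>\<close> is known on [-1,1] alone, so the composition
  passes through the Borel space restricted to that interval.\<close>
proof (rule measurable_compose[where f = "mix f w" and g = \<phi> and N = "restrict_space borel {-1..1}"])
  have "mix f w \<in> borel_measurable P"
    unfolding mix_def[abs_def] using meas by measurable
  then show "mix f w \<in> P \<rightarrow>\<^sub>M restrict_space borel {-1..1}"
    using mix_range[OF assms] by (intro measurable_restrict_space2) auto
  show "\<phi> \<in> borel_measurable (restrict_space borel {-1..1})"
    using surrogate
    by (intro borel_measurable_continuous_on_restrict) (simp add: convex_surrogate_def)
qed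

lemma surrogate_mix_norm_bound:
  assumes "w \<in> simplex_weights" and "x \<in> space P"
  shows "norm (\<phi> (mix f w x)) \<le> \<phi> 1"
  using convex_surrogate_bounds[OF surrogate mix_range[OF assms]] by simp

lemma surrogate_mix_integrable:
  assumes "w \<in> simplex_weights"
  shows "integrable P (\<lambda>x. \<phi> (mix f w x))"
  using surrogate_mix_norm_bound[OF assms] surrogate_mix_measurable[OF assms]
  by (intro integrable_const_bound[where B = "\<phi> 1"]) auto

lemma risk_bounds:
  assumes "w \<in> simplex_weights"
  shows "0 \<le> R_neg P \<phi> (mix f w)" and "R_neg P \<phi> (mix f w) \<le> \<phi> 1"
proof -
  note bounds = convex_surrogate_bounds[OF surrogate mix_range[OF assms]]
  show "0 \<le> R_neg P \<phi> (mix f w)"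
    unfolding R_neg_def by (rule Bochner_Integration.integral_nonneg) (rule bounds)
  show "R_neg P \<phi> (mix f w) \<le> \<phi> 1"
    unfolding R_neg_def
    by (rule integral_le_const[OF surrogate_mix_integrable[OF assms]]) (use bounds in auto)
qed

text \<open>\<open>mix f w x\<close> is affine in \<open>w\<close>, so convexity of
  \<open>\<phi>\<close> gives the inequality at each point \<open>x\<close>, and integration
  preserves it.\<close>

lemma risk_convex: "convex_on simplex_weights (\<lambda>w. R_neg P \<phi> (mix f w))"
proof (rule convex_onI[OF _ simplex_weights_convex])
  fix t :: real and v w :: "real ^ 'm"
  assume t: "0 < t" "t < 1" and vw: "v \<in> simplex_weights" "w \<in> simplex_weights"
  let ?u = "(1 - t) *\<^sub>R v + t *\<^sub>R w"
  have u: "?u \<in> simplex_weights"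
    using convexD[OF simplex_weights_convex vw, of "1 - t" t] t by simp
  have "R_neg P \<phi> (mix f ?u) \<le> (LINT x|P. (1 - t) * \<phi> (mix f v x) + t * \<phi> (mix f w x))"
    unfolding R_neg_def
  proof (rule integral_mono)
    show "integrable P (\<lambda>x. (1 - t) * \<phi> (mix f v x) + t * \<phi> (mix f w x))"
      using surrogate_mix_integrable vw by auto
    fix x assume "x \<in> space P"
    then show "\<phi> (mix f ?u x) \<le> (1 - t) * \<phi> (mix f v x) + t * \<phi> (mix f w x)"
      using convex_onD[of "{-1..1}" \<phi> t "mix f v x" "mix f w x"] surrogate t vw mix_range
      by (simp add: mix_convex_combination convex_surrogate_def)
  qed (rule surrogate_mix_integrable[OF u])
  also have "\<dots> = (1 - t) * R_neg P \<phi> (mix f v) + t * R_neg P \<phi> (mix f w)"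
    using surrogate_mix_integrable vw by (simp add: R_neg_def)
  finally show "R_neg P \<phi> (mix f ?u) \<le> (1 - t) * R_neg P \<phi> (mix f v) + t * R_neg P \<phi> (mix f w)" .
qed

text \<open>Dominated convergence along sequences of weights: the constant \<open>\<phi> 1\<close>
  bounds all integrands and is integrable under a probability measure.\<close>

lemma risk_continuous: "continuous_on simplex_weights (\<lambda>w. R_neg P \<phi> (mix f w))"
  unfolding continuous_on_sequentially R_neg_def comp_def
proof safe
  fix s and w :: "real ^ 'm"
  assume w: "w \<in> simplex_weights" and s: "\<forall>n. s n \<in> simplex_weights" and lim: "s \<longlonglongrightarrow> w"
  show "(\<lambda>n. LINT x|P. \<phi> (mix f (s n) x)) \<longlonglongrightarrow> (LINT x|P. \<phi> (mix f w x))"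
  proof (rule integral_dominated_convergence[where w = "\<lambda>_. \<phi> 1"])
    show "AE x in P. (\<lambda>n. \<phi> (mix f (s n) x)) \<longlonglongrightarrow> \<phi> (mix f w x)"
    proof (rule AE_I2)
      fix x assume x: "x \<in> space P"
      have "(\<lambda>n. mix f (s n) x) \<longlonglongrightarrow> mix f w x"
        unfolding mix_def by (intro tendsto_intros lim)
      then show "(\<lambda>n. \<phi> (mix f (s n) x)) \<longlonglongrightarrow> \<phi> (mix f w x)"
        by (rule continuous_on_tendsto_compose[where s = "{-1..1}", rotated])
          (use surrogate s w x mix_range in \<open>auto simp: convex_surrogate_def\<close>)
    qed
    show "\<And>n. AE x in P. norm (\<phi> (mix f (s n) x)) \<le> \<phi> 1"
      using s surrogate_mix_norm_bound by auto
  qed (use s w surrogate_mix_measurable in auto)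
qed

end

text \<open>The second instance rests on the symmetry of [-1,1] under negation; it supplies the
  facts about the positive risk.\<close>

lemma surrogate_risk_classifiers:
  assumes "distribution_on X P" and "convex_surrogate \<phi>" and "\<And>j. classifier X (hs j)"
  shows "surrogate_risk P hs \<phi>" and "surrogate_risk P (\<lambda>j x. - hs j x) \<phi>"
proof -
  interpret prob_space P using assms(1) by (simp add: distribution_on_def)
  have "hs j \<in> P \<rightarrow>\<^sub>M restrict_space borel {-1..1}" for j
    using assms(1,3) by (simp add: distribution_on_def classifier_def cong: measurable_cong_sets)
  then have "hs j \<in> borel_measurable P" "\<And>x. x \<in> space P \<Longrightarrow> hs j x \<in> {-1..1}" for j
    by (auto simp: measurable_restrict_space2_iff Pi_iff)
  then show "surrogate_risk P hs \<phi>" "surrogate_risk P (\<lambda>j x. - hs j x) \<phi>"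
    by (unfold_locales; use assms(2) in force)+
qed

text \<open>The sublevel set of \<open>F\<close> is closed in the compact \<open>S\<close>, hence
  compact, and \<open>v\<close> makes it nonempty; the continuous \<open>G\<close> attains its
  infimum there.\<close>

lemma arg_min_on_level_set:
  fixes F G :: "'a::t2_space \<Rightarrow> real"
  assumes "compact S" and "continuous_on S F" and "continuous_on S G"
    and "v \<in> S" and "F v \<le> a"
  obtains w where "w \<in> S" and "F w \<le> a" and "\<And>u. u \<in> S \<Longrightarrow> F u \<le> a \<Longrightarrow> G w \<le> G u"
proof -
  have "closedin (top_of_set S) (S \<inter> F -` {..a})"
    using assms(2) by (intro continuous_closedin_preimage) auto
  then have "compact (S \<inter> F -` {..a})"
    by (rule closedin_compact[OF assms(1)])
  moreover have "S \<inter> F -` {..a} \<noteq> {}"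
    using assms(4,5) by auto
  moreover have "continuous_on (S \<inter> F -` {..a}) G"
    using assms(3) by (rule continuous_on_subset) auto
  ultimately obtain w where "w \<in> S \<inter> F -` {..a}" "\<forall>u\<in>S \<inter> F -` {..a}. G w \<le> G u"
    using continuous_attains_inf by meson
  then show thesis by (intro that) auto
qed

text \<open>Lets the infima in the final bound be read as genuine minima, evaluated at the
  minimisers found.\<close>

lemma INF_eq_of_is_arg_min:
  fixes f :: "'a \<Rightarrow> real"
  assumes "is_arg_min f (\<lambda>h. h \<in> A) h"
  shows "(INF x\<in>A. f x) = f h"
proof (rule cInf_eq_minimum)
  show "f h \<in> f ` A"
    using assms by (auto simp: is_arg_min_def)
  show "\<And>y. y \<in> f ` A \<Longrightarrow> f h \<le> y"
    using assms by (auto simp: is_arg_min_def not_less)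
qed

theorem proposition4p1:
  fixes X :: "(real ^ 'd) set"
    and Pneg Ppos :: "(real ^ 'd) measure"
    and hs :: "'m::finite \<Rightarrow> real ^ 'd \<Rightarrow> real"
    and \<phi> :: "real \<Rightarrow> real"
    and \<alpha> \<nu>0 \<nu> :: real
  assumes "distribution_on X Pneg" and "distribution_on X Ppos"
    and "CARD('m) \<ge> 2" and "\<And>j. classifier X (hs j)"
    and "0 < \<alpha>" and "\<alpha> < 1"
    and "convex_surrogate \<phi>"
    and "\<nu>0 > 0" and "H_level Pneg \<phi> hs (\<alpha> - \<nu>0) \<noteq> {}"
    and "0 < \<nu>" and "\<nu> < \<nu>0"
  shows "(\<exists>h. is_arg_min (R_pos Ppos \<phi>) (\<lambda>h. h \<in> H_level Pneg \<phi> hs (\<alpha> - \<nu>)) h) \<and>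
    (\<exists>h. is_arg_min (R_pos Ppos \<phi>) (\<lambda>h. h \<in> H_level Pneg \<phi> hs \<alpha>) h) \<and>
    (INF h\<in>H_level Pneg \<phi> hs (\<alpha> - \<nu>). R_pos Ppos \<phi> h) - (INF h\<in>H_level Pneg \<phi> hs \<alpha>. R_pos Ppos \<phi> h)
      \<le> \<phi> 1 * (\<nu> / (\<nu>0 - \<nu>))"
proof -
  interpret neg: surrogate_risk Pneg hs \<phi>
    by (rule surrogate_risk_classifiers) fact+
  interpret pos: surrogate_risk Ppos "\<lambda>j x. - hs j x" \<phi>
    by (rule surrogate_risk_classifiers) fact+
  define S :: "(real ^ 'm) set" where "S = simplex_weights"
  define F where "F w = R_neg Pneg \<phi> (mix hs w)" for w
  define G where "G w = R_pos Ppos \<phi> (mix hs w)" for w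
  have G_eq: "G w = R_neg Ppos \<phi> (mix (\<lambda>j x. - hs j x) w)" for w
    by (simp add: G_def R_pos_def R_neg_def mix_uminus)
  \<comment> \<open>Feasible classifiers at each level are the images of a sublevel set of
    \<open>F\<close> on the simplex.\<close>
  have level_eq: "H_level Pneg \<phi> hs a = mix hs ` {w \<in> S. F w \<le> a}" for a
    by (auto simp: H_level_def H_conv_eq_image S_def F_def)
  have minimizer: "\<exists>w\<in>S. F w \<le> a \<and>
      is_arg_min (R_pos Ppos \<phi>) (\<lambda>h. h \<in> H_level Pneg \<phi> hs a) (mix hs w)"
    if v: "v \<in> S" "F v \<le> a" for v a
  proof -
    obtain w where "w \<in> S" "F w \<le> a" "\<And>u. u \<in> S \<Longrightarrow> F u \<le> a \<Longrightarrow> G w \<le> G u"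
      using arg_min_on_level_set[of S F G v a] v simplex_weights_compact
        neg.risk_continuous pos.risk_continuous
      unfolding S_def F_def[abs_def] G_eq[abs_def] by metis
    then show ?thesis
      by (intro bexI[of _ w]) (auto simp: level_eq is_arg_min_def not_less simp flip: G_def)
  qed

  \<comment> \<open>This \<open>v\<close> has two uses: it witnesses that the weaker levels
    \<open>\<alpha>\<close> and \<open>\<alpha> - \<nu>\<close> are feasible, and it is the point
    towards which the optimum \<open>w\<close> is shifted.\<close>
  obtain v where v: "v \<in> S" "F v \<le> \<alpha> - \<nu>0"
    using \<open>H_level Pneg \<phi> hs (\<alpha> - \<nu>0) \<noteq> {}\<close> by (auto simp: level_eq)
  obtain w where w: "w \<in> S" "F w \<le> \<alpha>"
    and w_min: "is_arg_min (R_pos Ppos \<phi>) (\<lambda>h. h \<in> H_level Pneg \<phi> hs \<alpha>) (mix hs w)"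
    using minimizer[of v \<alpha>] v \<open>\<nu>0 > 0\<close> by auto
  obtain w' where w'_min:
    "is_arg_min (R_pos Ppos \<phi>) (\<lambda>h. h \<in> H_level Pneg \<phi> hs (\<alpha> - \<nu>)) (mix hs w')"
    using minimizer[of v "\<alpha> - \<nu>"] v \<open>\<nu> < \<nu>0\<close> by auto

  \<comment> \<open>Chosen so that \<open>(1 - t) * \<alpha> + t * (\<alpha> - \<nu>0) = \<alpha> -
    t * \<nu>0\<close> is exactly \<open>\<alpha> - \<nu>\<close>.\<close>
  define t where "t = \<nu> / \<nu>0"
  have t: "0 \<le> t" "t \<le> 1" "t * \<nu>0 = \<nu>"
    using \<open>0 < \<nu>\<close> \<open>\<nu> < \<nu>0\<close> by (auto simp: t_def)
  let ?u = "(1 - t) *\<^sub>R w + t *\<^sub>R v"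
  have u: "?u \<in> S"
    using convexD[OF simplex_weights_convex, of w v "1 - t" t] t v w by (simp add: S_def)
  have "F ?u \<le> (1 - t) * F w + t * F v"
    using convex_onD[OF neg.risk_convex, of t w v] t v w by (simp add: F_def S_def)
  also have "\<dots> \<le> (1 - t) * \<alpha> + t * (\<alpha> - \<nu>0)"
    using t v w by (intro add_mono mult_left_mono) auto
  also have "\<dots> = \<alpha> - \<nu>"
    using t by (simp add: algebra_simps)
  finally have "G w' \<le> G ?u"
    using w'_min u by (auto simp: level_eq is_arg_min_def not_less simp flip: G_def)
  also have "\<dots> \<le> (1 - t) * G w + t * G v"
    using convex_onD[OF pos.risk_convex, of t w v] t v w by (simp add: G_eq S_def)
  finally have "G w' - G w \<le> t * (G v - G w)"
    by (simp add: algebra_simps)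
  \<comment> \<open>Here \<open>G v \<le> \<phi> 1\<close> and \<open>G w \<ge> 0\<close>.\<close>
  also have "\<dots> \<le> t * \<phi> 1"
    using t pos.risk_bounds(2)[of v] pos.risk_bounds(1)[of w] v w
    by (intro mult_left_mono) (auto simp: G_eq S_def)
  \<comment> \<open>Shrinking the denominator from \<open>\<nu>0\<close> to the still positive
    \<open>\<nu>0 - \<nu>\<close> enlarges the fraction, and
    \<open>\<phi> 1 \<ge> 0\<close>.\<close>
  also have "\<dots> \<le> \<phi> 1 * (\<nu> / (\<nu>0 - \<nu>))"
    unfolding t_def mult.commute[of _ "\<phi> 1"]
    using \<open>0 < \<nu>\<close> \<open>\<nu> < \<nu>0\<close> convex_surrogate_bounds(1)[OF \<open>convex_surrogate \<phi>\<close>, of 1]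
    by (intro mult_left_mono divide_left_mono) auto
  finally show ?thesis
    using w_min w'_min by (auto simp: INF_eq_of_is_arg_min simp flip: G_def)
qed

end
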